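(* Let $D$ be an integral domain with quotient field $K$. The map $\boldsymbol\lambda:\mathrm{LS}(D)\to\overline{\mathrm{SStar}}(D)$, $\mathcal F\mapsto\star_{\mathcal F}$, where $E^{\star_{\mathcal F}}:=\bigcup\{(E:H)\mid H\in\mathcal F\}$ for every nonzero $D$-submodule $E$ of $K$, establishes a homeomorphism between spaces endowed with the Zariski topologies.
   Context: $\overline{\mathbf F}(D)$ is the set of nonzero $D$-submodules of $K$; for a $D$-submodule $E$ of $K$ and an ideal $H$ of $D$, $(E:H):=\{x\in K\mid xH\subseteq E\}$. A semistar operation on $D$ is a map $\star:\overline{\mathbf F}(D)\to\overline{\mathbf F}(D)$, $E\mapsto E^\star$, such that for all $0\ne z\in K$ and $E,F\in\overline{\mathbf F}(D)$: $(zE)^\star=zE^\star$; $E\subseteq F\Rightarrow E^\star\subseteq F^\star$; $E\subseteq E^\star$; $(E^\star)^\star=E^\star$. $\mathrm{SStar}(D)$ is the set of all semistar operations on $D$; its Zariski topology has as a subbasis of open sets the sets $V_E:=\{\star\in\mathrm{SStar}(D)\mid 1\in E^\star\}$, $E\in\overline{\mathbf F}(D)$. A semistar operation $\star$ is stable if $(E\cap H)^\star=E^\star\cap H^\star$ for all $E,H\in\overline{\mathbf F}(D)$; $\overline{\mathrm{SStar}}(D)$ is the set of stable semistar operations on $D$, and its Zariski topology is the subspace topology from $\mathrm{SStar}(D)$. A localizing system on $D$ is a set $\mathcal F$ of ideals of $D$ such that: (i) if $I\in\mathcal F$ and $J$ is an ideal of $D$ such that $I\subseteq J$, then $J\in\mathcal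 F$; (ii) if $I\in\mathcal F$ and $J$ is an ideal of $D$ such that, for each $i\in I$, $(J:_D iD):=\{d\in D\mid di\in J\}\in\mathcal F$, then $J\in\mathcal F$. $\mathrm{LS}(D)$ is the set of all localizing systems on $D$; its Zariski topology has as subbasic open sets the sets $W_I:=\{\mathcal F\in\mathrm{LS}(D)\mid I\in\mathcal F\}$, as $I$ varies among the ideals of $D$.
   Formalization: Localizing systems are required to be nonempty sets of nonzero ideals: the empty family would give E^⋆ = ∅, and the family of all ideals has the same image as the family of all nonzero ideals (E ↦ K), so the map would not be injective. *)

theory Defs
  imports "HOL-Analysis.Analysis" "HOL-Computational_Algebra.Polynomial_Factorial"
begin

text \<open>The domain \<open>D\<close> is a type \<open>'a :: idom\<close>, its quotient field \<open>K\<close> is \<open>'a fract\<close>, and the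
  inclusion of \<open>D\<close> in \<open>K\<close> is \<^const>\<open>to_fract\<close>.\<close>

lemma module_fract: "module (\<lambda>(d::'a::idom) (x::'a fract). to_fract d * x)"
  by unfold_locales (simp_all add: algebra_simps)

lemma module_self: "module ((*) :: 'a::idom \<Rightarrow> 'a \<Rightarrow> 'a)"
  by unfold_locales (simp_all add: algebra_simps)

definition D_submodule :: "'a::idom fract set \<Rightarrow> bool" where
  "D_submodule E \<longleftrightarrow> module.subspace (\<lambda>(d::'a) x. to_fract d * x) E"

definition D_ideal :: "'a::idom set \<Rightarrow> bool" where
  "D_ideal I \<longleftrightarrow> module.subspace (*) I"

definition Fbar :: "'a::idom fract set set" where
  "Fbar = {E. D_submodule E \<and> E \<noteq> {0}}"

definition residual :: "'a::idom fract set \<Rightarrow> 'a set \<Rightarrow> 'a fract set" where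
  "residual E H = {x. (\<lambda>h. x * to_fract h) ` H \<subseteq> E}"


subsection \<open>Semistar operations\<close>

text \<open>Maps on \<^const>\<open>Fbar\<close> are extensional functions (\<open>undefined\<close> outside \<^const>\<open>Fbar\<close>), so that
  equality in HOL is equality of maps.\<close>

definition SStar :: "('a::idom fract set \<Rightarrow> 'a fract set) set" where
  "SStar = {star \<in> Fbar \<rightarrow>\<^sub>E Fbar.
     (\<forall>z. z \<noteq> 0 \<longrightarrow> (\<forall>E\<in>Fbar. star ((\<lambda>x. z * x) ` E) = (\<lambda>x. z * x) ` star E)) \<and>
     (\<forall>E\<in>Fbar. \<forall>F\<in>Fbar. E \<subseteq> F \<longrightarrow> star E \<subseteq> star F) \<and>
     (\<forall>E\<in>Fbar. E \<subseteq> star E) \<and>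
     (\<forall>E\<in>Fbar. star (star E) = star E)}"

definition stable_SStar :: "('a::idom fract set \<Rightarrow> 'a fract set) set" where
  "stable_SStar = {star \<in> SStar. \<forall>E\<in>Fbar. \<forall>H\<in>Fbar. star (E \<inter> H) = star E \<inter> star H}"

definition SStar_zariski :: "('a::idom fract set \<Rightarrow> 'a fract set) topology" where
  "SStar_zariski = topology_generated_by ((\<lambda>E. {star \<in> SStar. 1 \<in> star E}) ` Fbar)"

definition stable_SStar_zariski :: "('a::idom fract set \<Rightarrow> 'a fract set) topology" where
  "stable_SStar_zariski = subtopology SStar_zariski stable_SStar"


subsection \<open>Localizing systems\<close>

text \<open>A localizing system is a nonempty set of nonzero ideals. Both conventions are needed for
  \<open>star_of\<close> below to be a bijection onto the stable semistar operations: the empty family would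
  send every \<open>E\<close> to the empty set, and the family of all ideals (zero included) would have the same
  image as the family of all nonzero ideals, namely the operation with constant value \<open>K\<close>.\<close>

definition localizing_system :: "'a::idom set set \<Rightarrow> bool" where
  "localizing_system \<F> \<longleftrightarrow>
     \<F> \<noteq> {} \<and> (\<forall>I\<in>\<F>. D_ideal I \<and> I \<noteq> {0}) \<and>
     (\<forall>I\<in>\<F>. \<forall>J. D_ideal J \<and> I \<subseteq> J \<longrightarrow> J \<in> \<F>) \<and>
     (\<forall>I\<in>\<F>. \<forall>J. D_ideal J \<and> (\<forall>i\<in>I. {d. d * i \<in> J} \<in> \<F>) \<longrightarrow> J \<in> \<F>)"

definition LS :: "'a::idom set set set" where
  "LS = {\<F>. localizing_system \<F>}"

definition LS_zariski :: "'a::idom set set topology" where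
  "LS_zariski = topology_generated_by ((\<lambda>I. {\<F> \<in> LS. I \<in> \<F>}) ` {I. D_ideal I})"

definition star_of :: "'a::idom set set \<Rightarrow> 'a fract set \<Rightarrow> 'a fract set" where
  "star_of \<F> = (\<lambda>E\<in>Fbar. \<Union>{residual E H | H. H \<in> \<F>})"


subsection \<open>The underlying sets of the spaces\<close>

lemma topspace_SStar_zariski: "topspace (SStar_zariski :: ('a::idom fract set \<Rightarrow> _) topology) = SStar"
proof -
  have "(1 :: 'a fract) \<notin> {0}"
    by simp
  then have "(UNIV :: 'a fract set) \<noteq> {0}"
    by (metis UNIV_I)
  then have UNIV_Fbar: "(UNIV :: 'a fract set) \<in> Fbar"
    using module.subspace_UNIV[OF module_fract] unfolding Fbar_def D_submodule_def by simp
  have "1 \<in> star UNIV" if "star \<in> SStar" for star :: "'a fract set \<Rightarrow> 'a fract set"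
  proof -
    have "\<forall>E\<in>Fbar. E \<subseteq> star E"
      using that unfolding SStar_def by simp
    then show ?thesis
      using UNIV_Fbar by (metis UNIV_I subsetD)
  qed
  then show ?thesis
    unfolding SStar_zariski_def topology_generated_by_topspace
    by (intro equalityI subsetI UN_I[OF UNIV_Fbar]) simp_all
qed

lemma topspace_stable_SStar_zariski: "topspace stable_SStar_zariski = stable_SStar"
proof -
  have "stable_SStar \<subseteq> SStar"
    unfolding stable_SStar_def by (rule Collect_restrict)
  then show ?thesis
    unfolding stable_SStar_zariski_def topspace_subtopology topspace_SStar_zariski by (rule Int_absorb1)
qed

lemma topspace_LS_zariski: "topspace (LS_zariski :: 'a::idom set set topology) = LS"
proof -
  have U: "(UNIV :: 'a set) \<in> {I. D_ideal I}"
    using module.subspace_UNIV[OF module_self] unfolding D_ideal_def by simp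
  have "UNIV \<in> \<F>" if "\<F> \<in> LS" for \<F> :: "'a set set"
  proof -
    have "localizing_system \<F>"
      using that by (simp add: LS_def)
    then have "\<F> \<noteq> {} \<and> (\<forall>I\<in>\<F>. \<forall>J. D_ideal J \<and> I \<subseteq> J \<longrightarrow> J \<in> \<F>)"
      unfolding localizing_system_def by (elim conjE) (intro conjI)
    then show ?thesis
      using U by (metis all_not_in_conv mem_Collect_eq subset_UNIV)
  qed
  then show ?thesis
    unfolding LS_zariski_def topology_generated_by_topspace
    by (intro equalityI subsetI UN_I[OF U]) simp_all
qed

end

theory Submission
  imports Defs
begin

text \<open>
  Everything rests on the conductor \<open>(E :\<^sub>D x) = {d \<in> D. d x \<in> E}\<close>, an ideal of \<open>D\<close>.
  If \<open>x H \<subseteq> E\<close> with \<open>H\<close> in a localizing system \<open>\<F>\<close>, then \<open>H\<close> lies in the conductor; conversely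
  \<open>x\<close> carries its own conductor into \<open>E\<close>. As \<open>\<F>\<close> is closed under enlarging ideals, this gives
  \<open>x \<in> E\<^sup>\<star> \<longleftrightarrow> (E :\<^sub>D x) \<in> \<F>\<close> for \<open>\<star> = \<star>\<^sub>\<F>\<close> (lemma \<open>mem_star_of_iff\<close>), and the union
  defining \<open>\<star>\<^sub>\<F>\<close> disappears from all later arguments. The semistar axioms and stability translate
  into closure properties of \<open>\<F>\<close>: stability is closure under intersections, because
  \<open>(E \<inter> H :\<^sub>D x) = (E :\<^sub>D x) \<inter> (H :\<^sub>D x)\<close>, and idempotence is axiom (ii).

  The inverse map sends \<open>\<star>\<close> to the set of nonzero ideals \<open>I\<close> with \<open>1 \<in> I\<^sup>\<star>\<close>. It undoes
  \<open>\<F> \<mapsto> \<star>\<^sub>\<F>\<close> because \<open>(I :\<^sub>D 1) = I\<close>. In the other order, the conductor of \<open>x \<noteq> 0\<close> is, inside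
  \<open>K\<close>, the intersection \<open>D \<inter> x\<^sup>-\<^sup>1 E\<close>; a stable \<open>\<star>\<close> sends it to \<open>D\<^sup>\<star> \<inter> x\<^sup>-\<^sup>1 E\<^sup>\<star>\<close>,
  which contains \<open>1\<close> exactly when \<open>x \<in> E\<^sup>\<star>\<close> (lemma \<open>one_in_star_colon_iff\<close>).

  Both maps are continuous since each pulls a subbasic set back to a subbasic or empty set:
  \<open>1 \<in> E\<^sup>\<star>\<close> is the condition \<open>(E :\<^sub>D 1) \<in> \<F>\<close>, and \<open>I \<in> \<F>\<close> is, for
  \<open>I \<noteq> 0\<close>, the condition \<open>1 \<in> I\<^sup>\<star>\<close>.
\<close>


section \<open>Submodules of the quotient field and conductors\<close>

lemma D_submodule_iff:
  "D_submodule E \<longleftrightarrow>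
     0 \<in> E \<and> (\<forall>x\<in>E. \<forall>y\<in>E. x + y \<in> E) \<and> (\<forall>d. \<forall>x\<in>E. to_fract d * x \<in> E)"
  unfolding D_submodule_def module.subspace_def[OF module_fract] by blast

lemma D_ideal_iff:
  "D_ideal I \<longleftrightarrow> 0 \<in> I \<and> (\<forall>x\<in>I. \<forall>y\<in>I. x + y \<in> I) \<and> (\<forall>d. \<forall>x\<in>I. d * x \<in> I)"
  unfolding D_ideal_def module.subspace_def[OF module_self] by blast

lemma Fbar_submodule: "E \<in> Fbar \<Longrightarrow> D_submodule E"
  by (simp add: Fbar_def)

lemma Fbar_zero: "E \<in> Fbar \<Longrightarrow> 0 \<in> E"
  by (simp add: Fbar_def D_submodule_iff)

lemma Fbar_scale: "E \<in> Fbar \<Longrightarrow> x \<in> E \<Longrightarrow> to_fract d * x \<in> E"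
  by (simp add: Fbar_def D_submodule_iff)

lemma Fbar_obtain_nonzero:
  assumes "E \<in> Fbar"
  obtains e where "e \<in> E" "e \<noteq> 0"
  using assms Fbar_zero[OF assms] unfolding Fbar_def by blast

lemma fract_as_quotient:
  fixes x :: "'a::idom fract"
  obtains a b where "b \<noteq> 0" "to_fract b * x = to_fract a"
proof (cases x)
  case (Fract a b)
  then show ?thesis
    by (intro that[of b a]) (simp_all add: to_fract_def eq_fract)
qed

definition colon :: "'a::idom fract set \<Rightarrow> 'a fract \<Rightarrow> 'a set" where
  "colon E x = {d. to_fract d * x \<in> E}"

lemma mem_colon: "d \<in> colon E x \<longleftrightarrow> to_fract d * x \<in> E"
  by (simp add: colon_def)

lemma D_ideal_colon: "D_submodule E \<Longrightarrow> D_ideal (colon E x)"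
  by (auto simp: D_ideal_iff D_submodule_iff mem_colon distrib_right mult.assoc)

text \<open>Any two nonzero fractions have a common nonzero multiple over \<open>D\<close>, so every element of the
  quotient field is brought into a given nonzero submodule by some nonzero denominator.\<close>

lemma colon_nonzero:
  assumes E: "E \<in> Fbar"
  obtains c where "c \<in> colon E x" "c \<noteq> 0"
proof -
  obtain e where e: "e \<in> E" "e \<noteq> 0"
    by (rule Fbar_obtain_nonzero[OF E])
  obtain a b where ab: "b \<noteq> 0" "to_fract b * x = to_fract a"
    by (rule fract_as_quotient)
  obtain p q where pq: "q \<noteq> 0" "to_fract q * e = to_fract p"
    by (rule fract_as_quotient)
  have "p \<noteq> 0"
    using pq e by (metis mult_eq_0_iff to_fract_eq_0_iff)
  have "to_fract (p * b) * x = to_fract p * to_fract a"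
    by (simp add: ab(2) mult.assoc)
  also have "\<dots> = to_fract (a * q) * e"
    by (simp add: pq(2)[symmetric] mult_ac)
  finally have "p * b \<in> colon E x"
    using Fbar_scale[OF E e(1), of "a * q"] by (simp only: mem_colon)
  then show ?thesis
    using \<open>p \<noteq> 0\<close> ab(1) that[of "p * b"] by simp
qed

lemma colon_neq_zero: "E \<in> Fbar \<Longrightarrow> colon E x \<noteq> {0}"
  using colon_nonzero by (metis singletonD)

lemma Int_in_Fbar:
  assumes E: "E \<in> Fbar" and H: "H \<in> Fbar"
  shows "E \<inter> H \<in> Fbar"
proof -
  obtain h where h: "h \<in> H" "h \<noteq> 0"
    by (rule Fbar_obtain_nonzero[OF H])
  obtain c where c: "c \<in> colon E h" "c \<noteq> 0"
    by (rule colon_nonzero[OF E])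
  have "to_fract c * h \<in> E \<inter> H" "to_fract c * h \<noteq> 0"
    using c h Fbar_scale[OF H h(1)] by (auto simp: mem_colon)
  then have "E \<inter> H \<noteq> {0}"
    by blast
  then show ?thesis
    using E H by (auto simp: Fbar_def D_submodule_iff)
qed

lemma scale_in_Fbar:
  assumes E: "E \<in> Fbar" and z: "z \<noteq> 0"
  shows "(\<lambda>x. z * x) ` E \<in> Fbar"
proof -
  obtain e where "e \<in> E" "e \<noteq> 0"
    by (rule Fbar_obtain_nonzero[OF E])
  then have "z * e \<in> (\<lambda>x. z * x) ` E" "z * e \<noteq> 0"
    using z by auto
  then have "(\<lambda>x. z * x) ` E \<noteq> {0}"
    by blast
  moreover have "D_submodule ((\<lambda>x. z * x) ` E)"
    using Fbar_submodule[OF E] unfolding D_submodule_iff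
    by (auto simp: image_iff distrib_left[symmetric] mult.left_commute[of _ z] z)
  ultimately show ?thesis
    by (simp add: Fbar_def)
qed

lemma mem_scale_iff:
  fixes z :: "'a::idom fract"
  assumes "z \<noteq> 0"
  shows "x \<in> (\<lambda>y. z * y) ` E \<longleftrightarrow> inverse z * x \<in> E"
proof
  assume "inverse z * x \<in> E"
  then have "z * (inverse z * x) \<in> (\<lambda>y. z * y) ` E"
    by blast
  then show "x \<in> (\<lambda>y. z * y) ` E"
    using assms by (simp add: mult.assoc[symmetric])
qed (use assms in \<open>auto simp: mult.assoc[symmetric]\<close>)

lemma ideal_in_Fbar:
  assumes "D_ideal I" "I \<noteq> {0}"
  shows "to_fract ` I \<in> Fbar"
proof -
  have "\<exists>i\<in>I. i \<noteq> 0"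
    using assms unfolding D_ideal_iff by blast
  then have "to_fract ` I \<noteq> {0}"
    by (metis image_eqI singletonD to_fract_eq_0_iff)
  then show ?thesis
    using assms(1) unfolding Fbar_def D_ideal_iff D_submodule_iff
    by (auto simp: image_iff to_fract_add[symmetric] to_fract_mult[symmetric]
             simp del: to_fract_add to_fract_mult)
qed

lemma D_ideal_UNIV: "D_ideal UNIV"
  by (simp add: D_ideal_iff)

lemma UNIV_neq_zero: "(UNIV :: 'a::idom set) \<noteq> {0}"
  by (metis (full_types) UNIV_I one_neq_zero singletonD)

lemma colon_ideal_one: "colon (to_fract ` I) 1 = I"
  by (auto simp: mem_colon)


section \<open>The operation of a localizing system\<close>

lemma LS_ideal: "\<F> \<in> LS \<Longrightarrow> I \<in> \<F> \<Longrightarrow> D_ideal I \<and> I \<noteq> {0}"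
  unfolding LS_def localizing_system_def by blast

lemma LS_upward: "\<F> \<in> LS \<Longrightarrow> I \<in> \<F> \<Longrightarrow> D_ideal J \<Longrightarrow> I \<subseteq> J \<Longrightarrow> J \<in> \<F>"
  unfolding LS_def localizing_system_def by blast

lemma LS_local:
  "\<F> \<in> LS \<Longrightarrow> I \<in> \<F> \<Longrightarrow> D_ideal J \<Longrightarrow> (\<And>i. i \<in> I \<Longrightarrow> {d. d * i \<in> J} \<in> \<F>) \<Longrightarrow> J \<in> \<F>"
  unfolding LS_def localizing_system_def by blast

lemma LS_UNIV:
  assumes "\<F> \<in> LS"
  shows "UNIV \<in> \<F>"
proof -
  obtain I where "I \<in> \<F>"
    using assms unfolding LS_def localizing_system_def by blast
  then show ?thesis
    using LS_upward[OF assms] by (auto simp: D_ideal_iff)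
qed

text \<open>For \<open>i \<in> I\<close> the conductors of \<open>i\<close> in \<open>I \<inter> J\<close> and in \<open>J\<close> agree, and the latter contains \<open>J\<close>;
  so axiom (ii) applies to \<open>I \<inter> J\<close>.\<close>

lemma LS_Int:
  assumes F: "\<F> \<in> LS" and I: "I \<in> \<F>" and J: "J \<in> \<F>"
  shows "I \<inter> J \<in> \<F>"
proof (rule LS_local[OF F I])
  have ideals: "D_ideal I" "D_ideal J"
    using LS_ideal[OF F] I J by blast+
  then show "D_ideal (I \<inter> J)"
    by (simp add: D_ideal_iff)
  fix i assume "i \<in> I"
  show "{d. d * i \<in> I \<inter> J} \<in> \<F>"
  proof (rule LS_upward[OF F J])
    show "D_ideal {d. d * i \<in> I \<inter> J}"
      using ideals by (simp add: D_ideal_iff distrib_right mult.assoc)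
    show "J \<subseteq> {d. d * i \<in> I \<inter> J}"
      using ideals \<open>i \<in> I\<close> by (auto simp: D_ideal_iff) (metis mult.commute)
  qed
qed

lemma mem_residual_iff: "x \<in> residual E H \<longleftrightarrow> H \<subseteq> colon E x"
  by (auto simp: residual_def mem_colon mult.commute[of x])

text \<open>Among the ideals \<open>H\<close> with \<open>x H \<subseteq> E\<close> the conductor is the largest, so it suffices to test
  that one.\<close>

lemma mem_star_of_iff:
  assumes F: "\<F> \<in> LS" and E: "E \<in> Fbar"
  shows "x \<in> star_of \<F> E \<longleftrightarrow> colon E x \<in> \<F>"
proof -
  have "x \<in> star_of \<F> E \<longleftrightarrow> (\<exists>H\<in>\<F>. H \<subseteq> colon E x)"
    using E by (simp add: star_of_def) (use mem_residual_iff in blast)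
  also have "\<dots> \<longleftrightarrow> colon E x \<in> \<F>"
    using LS_upward[OF F _ D_ideal_colon[OF Fbar_submodule[OF E]]] by blast
  finally show ?thesis .
qed

lemma star_of_extensive:
  assumes F: "\<F> \<in> LS" and E: "E \<in> Fbar"
  shows "E \<subseteq> star_of \<F> E"
proof
  fix x assume "x \<in> E"
  then have "colon E x = UNIV"
    using Fbar_scale[OF E] by (auto simp: mem_colon)
  then show "x \<in> star_of \<F> E"
    by (simp add: mem_star_of_iff[OF F E] LS_UNIV[OF F])
qed

lemma star_of_in_Fbar:
  assumes F: "\<F> \<in> LS" and E: "E \<in> Fbar"
  shows "star_of \<F> E \<in> Fbar"
proof -
  have D: "D_submodule E"
    by (rule Fbar_submodule[OF E])
  have "0 \<in> star_of \<F> E"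
    using star_of_extensive[OF F E] Fbar_zero[OF E] by blast
  moreover have "x + y \<in> star_of \<F> E" if "x \<in> star_of \<F> E" "y \<in> star_of \<F> E" for x y
  proof -
    have "colon E x \<inter> colon E y \<in> \<F>"
      using that LS_Int[OF F] by (simp add: mem_star_of_iff[OF F E])
    moreover have "colon E x \<inter> colon E y \<subseteq> colon E (x + y)"
      using D by (auto simp: mem_colon distrib_left D_submodule_iff)
    ultimately show ?thesis
      unfolding mem_star_of_iff[OF F E] using LS_upward[OF F _ D_ideal_colon[OF D]] by blast
  qed
  moreover have "to_fract d * x \<in> star_of \<F> E" if "x \<in> star_of \<F> E" for d x
  proof -
    have "colon E x \<subseteq> colon E (to_fract d * x)"
      using Fbar_scale[OF E] by (auto simp: mem_colon mult.left_commute[of _ "to_fract d"])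
    then show ?thesis
      using that LS_upward[OF F _ D_ideal_colon[OF D]] unfolding mem_star_of_iff[OF F E] by blast
  qed
  moreover have "star_of \<F> E \<noteq> {0}"
    using star_of_extensive[OF F E] by (metis Fbar_obtain_nonzero[OF E] singletonD subsetD)
  ultimately show ?thesis
    by (simp add: Fbar_def D_submodule_iff)
qed

lemma star_of_mono:
  assumes F: "\<F> \<in> LS" and E: "E \<in> Fbar" and H: "H \<in> Fbar" and "E \<subseteq> H"
  shows "star_of \<F> E \<subseteq> star_of \<F> H"
proof
  fix x assume "x \<in> star_of \<F> E"
  moreover have "colon E x \<subseteq> colon H x"
    using \<open>E \<subseteq> H\<close> by (auto simp: mem_colon)
  ultimately show "x \<in> star_of \<F> H"
    unfolding mem_star_of_iff[OF F E] mem_star_of_iff[OF F H]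
    using LS_upward[OF F _ D_ideal_colon[OF Fbar_submodule[OF H]]] by blast
qed

text \<open>Write \<open>\<star>\<close> for the operation. If \<open>h x \<in> E\<^sup>\<star>\<close>, then the conductor of \<open>h x\<close> in \<open>E\<close> is in the
  localizing system; that conductor is also the conductor of \<open>h\<close> in the ideal \<open>(E :\<^sub>D x)\<close>.
  Hence axiom (ii), applied to the ideal \<open>(E\<^sup>\<star> :\<^sub>D x)\<close> and to \<open>(E :\<^sub>D x)\<close>, is idempotence.\<close>

lemma star_of_idem:
  assumes F: "\<F> \<in> LS" and E: "E \<in> Fbar"
  shows "star_of \<F> (star_of \<F> E) = star_of \<F> E"
proof
  note sE = star_of_in_Fbar[OF F E]
  show "star_of \<F> E \<subseteq> star_of \<F> (star_of \<F> E)"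
    by (rule star_of_extensive[OF F sE])
  show "star_of \<F> (star_of \<F> E) \<subseteq> star_of \<F> E"
  proof
    fix x assume "x \<in> star_of \<F> (star_of \<F> E)"
    then have "colon (star_of \<F> E) x \<in> \<F>"
      by (simp add: mem_star_of_iff[OF F sE])
    then have "colon E x \<in> \<F>"
    proof (rule LS_local[OF F])
      show "D_ideal (colon E x)"
        by (rule D_ideal_colon[OF Fbar_submodule[OF E]])
      fix h assume "h \<in> colon (star_of \<F> E) x"
      then have "colon E (to_fract h * x) \<in> \<F>"
        by (simp add: mem_colon mem_star_of_iff[OF F E])
      moreover have "colon E (to_fract h * x) = {d. d * h \<in> colon E x}"
        by (auto simp: mem_colon mult.assoc)
      ultimately show "{d. d * h \<in> colon E x} \<in> \<F>"
        by simp
    qed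
    then show "x \<in> star_of \<F> E"
      by (simp add: mem_star_of_iff[OF F E])
  qed
qed

lemma star_of_scale:
  assumes F: "\<F> \<in> LS" and E: "E \<in> Fbar" and z: "z \<noteq> 0"
  shows "star_of \<F> ((\<lambda>x. z * x) ` E) = (\<lambda>x. z * x) ` star_of \<F> E"
proof -
  have "colon ((\<lambda>x. z * x) ` E) x = colon E (inverse z * x)" for x
    by (auto simp: mem_colon mem_scale_iff[OF z] mult.left_commute)
  then show ?thesis
    by (intro set_eqI) (simp add: mem_scale_iff[OF z] mem_star_of_iff[OF F E]
        mem_star_of_iff[OF F scale_in_Fbar[OF E z]])
qed

lemma star_of_Int:
  assumes F: "\<F> \<in> LS" and E: "E \<in> Fbar" and H: "H \<in> Fbar"
  shows "star_of \<F> (E \<inter> H) = star_of \<F> E \<inter> star_of \<F> H"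
proof
  note EH = Int_in_Fbar[OF E H]
  show "star_of \<F> (E \<inter> H) \<subseteq> star_of \<F> E \<inter> star_of \<F> H"
    using star_of_mono[OF F EH E] star_of_mono[OF F EH H] by blast
  have "colon (E \<inter> H) x = colon E x \<inter> colon H x" for x
    by (auto simp: mem_colon)
  then show "star_of \<F> E \<inter> star_of \<F> H \<subseteq> star_of \<F> (E \<inter> H)"
    using LS_Int[OF F]
    by (auto simp: mem_star_of_iff[OF F E] mem_star_of_iff[OF F H] mem_star_of_iff[OF F EH])
qed

lemma star_of_stable_SStar:
  assumes F: "\<F> \<in> LS"
  shows "star_of \<F> \<in> stable_SStar"
proof -
  have "star_of \<F> \<in> Fbar \<rightarrow>\<^sub>E Fbar"
    using star_of_in_Fbar[OF F] by (auto simp: star_of_def)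
  then have "star_of \<F> \<in> SStar"
    unfolding SStar_def
    by (simp add: star_of_scale[OF F] star_of_mono[OF F] star_of_extensive[OF F] star_of_idem[OF F])
  then show ?thesis
    by (simp add: stable_SStar_def star_of_Int[OF F])
qed


section \<open>The localizing system of a stable semistar operation\<close>

lemma SStar_in_Fbar: "star \<in> SStar \<Longrightarrow> E \<in> Fbar \<Longrightarrow> star E \<in> Fbar"
  unfolding SStar_def by auto

lemma SStar_scale:
  "star \<in> SStar \<Longrightarrow> E \<in> Fbar \<Longrightarrow> z \<noteq> 0 \<Longrightarrow> star ((\<lambda>x. z * x) ` E) = (\<lambda>x. z * x) ` star E"
  unfolding SStar_def by simp

lemma SStar_mono: "star \<in> SStar \<Longrightarrow> E \<in> Fbar \<Longrightarrow> H \<in> Fbar \<Longrightarrow> E \<subseteq> H \<Longrightarrow> star E \<subseteq> star H"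
  unfolding SStar_def by blast

lemma SStar_extensive: "star \<in> SStar \<Longrightarrow> E \<in> Fbar \<Longrightarrow> E \<subseteq> star E"
  unfolding SStar_def by blast

lemma SStar_idem: "star \<in> SStar \<Longrightarrow> E \<in> Fbar \<Longrightarrow> star (star E) = star E"
  unfolding SStar_def by blast

lemma one_in_star_range:
  assumes "star \<in> SStar"
  shows "1 \<in> star (range to_fract)"
  using SStar_extensive[OF assms ideal_in_Fbar[OF D_ideal_UNIV UNIV_neq_zero]]
  by (metis rangeI subsetD to_fract_1)

definition ideals_of :: "('a::idom fract set \<Rightarrow> 'a fract set) \<Rightarrow> 'a set set" where
  "ideals_of star = {I. D_ideal I \<and> I \<noteq> {0} \<and> 1 \<in> star (to_fract ` I)}"

text \<open>Axiom (ii) is idempotence again: if every conductor \<open>(J :\<^sub>D i)\<close> with \<open>i \<in> I\<close> has \<open>1\<close> in its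
  closure, then multiplying by \<open>i\<close> gives \<open>i \<in> J\<^sup>\<star>\<close>; so \<open>I \<subseteq> J\<^sup>\<star>\<close> and \<open>1 \<in> I\<^sup>\<star> \<subseteq> J\<^sup>\<star>\<^sup>\<star> = J\<^sup>\<star>\<close>.\<close>

lemma ideals_of_in_LS:
  fixes star :: "'a::idom fract set \<Rightarrow> 'a fract set"
  assumes S: "star \<in> SStar"
  shows "ideals_of star \<in> LS"
proof -
  have "UNIV \<in> ideals_of star"
    by (simp add: ideals_of_def D_ideal_UNIV UNIV_neq_zero one_in_star_range[OF S])
  moreover have "J \<in> ideals_of star"
    if I: "I \<in> ideals_of star" and J: "D_ideal J" and "I \<subseteq> J" for I J
  proof -
    have "D_ideal I" "I \<noteq> {0}" "1 \<in> star (to_fract ` I)"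
      using I by (auto simp: ideals_of_def)
    moreover have "J \<noteq> {0}"
      using calculation \<open>I \<subseteq> J\<close> by (auto simp: D_ideal_iff)
    ultimately show ?thesis
      using SStar_mono[OF S ideal_in_Fbar ideal_in_Fbar, of I J] \<open>I \<subseteq> J\<close> J
      by (auto simp: ideals_of_def)
  qed
  moreover have "J \<in> ideals_of star"
    if I: "I \<in> ideals_of star" and J: "D_ideal J"
      and loc: "\<And>i. i \<in> I \<Longrightarrow> {d. d * i \<in> J} \<in> ideals_of star" for I J
  proof -
    have I': "D_ideal I" "I \<noteq> {0}" "1 \<in> star (to_fract ` I)"
      using I by (auto simp: ideals_of_def)
    then obtain i where i: "i \<in> I" "i \<noteq> 0"
      by (auto simp: D_ideal_iff)
    have "D_ideal {d. d * i \<in> J}" "{d. d * i \<in> J} \<noteq> {0}"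
      using loc[OF i(1)] by (auto simp: ideals_of_def)
    then obtain d where "d * i \<in> J" "d \<noteq> 0"
      unfolding D_ideal_iff by blast
    then have "J \<noteq> {0}"
      using i(2) by auto
    note FI = ideal_in_Fbar[OF I'(1,2)] and FJ = ideal_in_Fbar[OF J \<open>J \<noteq> {0}\<close>]
    have "to_fract ` I \<subseteq> star (to_fract ` J)"
    proof clarify
      fix k assume "k \<in> I"
      show "to_fract k \<in> star (to_fract ` J)"
      proof (cases "k = 0")
        case True
        then show ?thesis
          using Fbar_zero[OF SStar_in_Fbar[OF S FJ]] by simp
      next
        case False
        let ?C = "to_fract ` {d. d * k \<in> J}"
        have C: "?C \<in> Fbar" "1 \<in> star ?C"
          using loc[OF \<open>k \<in> I\<close>] ideal_in_Fbar by (auto simp: ideals_of_def)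
        have k: "to_fract k \<noteq> 0"
          using False by simp
        have "to_fract k * 1 \<in> (\<lambda>x. to_fract k * x) ` star ?C"
          using C(2) by blast
        also have "\<dots> = star ((\<lambda>x. to_fract k * x) ` ?C)"
          using SStar_scale[OF S C(1) k] by simp
        also have "\<dots> \<subseteq> star (to_fract ` J)"
        proof (rule SStar_mono[OF S scale_in_Fbar[OF C(1) k] FJ])
          show "(\<lambda>x. to_fract k * x) ` ?C \<subseteq> to_fract ` J"
            by (auto simp: image_iff to_fract_mult[symmetric] mult.commute[of k]
                simp del: to_fract_mult)
        qed
        finally show ?thesis
          by simp
      qed
    qed
    then have "star (to_fract ` I) \<subseteq> star (to_fract ` J)"
      using SStar_mono[OF S FI SStar_in_Fbar[OF S FJ]] SStar_idem[OF S FJ] by simp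
    then show ?thesis
      using I'(3) J \<open>J \<noteq> {0}\<close> by (auto simp: ideals_of_def)
  qed
  moreover have "\<forall>I\<in>ideals_of star. D_ideal I \<and> I \<noteq> {0}"
    by (simp add: ideals_of_def)
  ultimately show ?thesis
    unfolding LS_def localizing_system_def by blast
qed

lemma ideals_of_star_of:
  assumes F: "\<F> \<in> LS"
  shows "ideals_of (star_of \<F>) = \<F>"
proof -
  have "1 \<in> star_of \<F> (to_fract ` I) \<longleftrightarrow> I \<in> \<F>" if "D_ideal I" "I \<noteq> {0}" for I
    by (simp add: mem_star_of_iff[OF F ideal_in_Fbar[OF that]] colon_ideal_one)
  then show ?thesis
    using LS_ideal[OF F] unfolding ideals_of_def by blast
qed

lemma to_fract_image_colon:
  assumes "x \<noteq> 0"
  shows "to_fract ` colon E x = range to_fract \<inter> (\<lambda>y. inverse x * y) ` E"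
proof -
  have "inverse x \<noteq> 0"
    using assms by simp
  then have "d \<in> colon E x \<longleftrightarrow> to_fract d \<in> (\<lambda>y. inverse x * y) ` E" for d
    by (simp add: mem_scale_iff mem_colon mult.commute[of x])
  then show ?thesis
    by blast
qed

text \<open>Stability splits the closure of \<open>(E :\<^sub>D x) = D \<inter> x\<^sup>-\<^sup>1 E\<close> into \<open>D\<^sup>\<star> \<inter> x\<^sup>-\<^sup>1 E\<^sup>\<star>\<close>,
  and \<open>1\<close> is always in the first part. For \<open>x = 0\<close> both sides hold.\<close>

lemma one_in_star_colon_iff:
  fixes star :: "'a::idom fract set \<Rightarrow> 'a fract set"
  assumes S: "star \<in> stable_SStar" and E: "E \<in> Fbar"
  shows "1 \<in> star (to_fract ` colon E x) \<longleftrightarrow> x \<in> star E"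
proof -
  have S': "star \<in> SStar"
    using S by (simp add: stable_SStar_def)
  have D: "range (to_fract :: 'a \<Rightarrow> _) \<in> Fbar"
    by (rule ideal_in_Fbar[OF D_ideal_UNIV UNIV_neq_zero])
  have one: "1 \<in> star (range (to_fract :: 'a \<Rightarrow> _))"
    by (rule one_in_star_range[OF S'])
  show ?thesis
  proof (cases "x = 0")
    case True
    then have "colon E x = UNIV"
      using Fbar_zero[OF E] by (auto simp: mem_colon)
    then show ?thesis
      using True one Fbar_zero[OF SStar_in_Fbar[OF S' E]] by simp
  next
    case False
    then have x: "inverse x \<noteq> 0"
      by simp
    have "star (to_fract ` colon E x) =
        star (range to_fract) \<inter> (\<lambda>y. inverse x * y) ` star E"
      using S D scale_in_Fbar[OF E x] SStar_scale[OF S' E x]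
      by (simp add: to_fract_image_colon[OF False] stable_SStar_def)
    then show ?thesis
      using one by (simp add: mem_scale_iff[OF x])
  qed
qed

lemma star_of_ideals_of:
  assumes S: "star \<in> stable_SStar"
  shows "star_of (ideals_of star) = star"
proof
  fix E
  have S': "star \<in> SStar"
    using S by (simp add: stable_SStar_def)
  show "star_of (ideals_of star) E = star E"
  proof (cases "E \<in> Fbar")
    case True
    have "colon E x \<in> ideals_of star \<longleftrightarrow> x \<in> star E" for x
      by (simp add: ideals_of_def D_ideal_colon[OF Fbar_submodule[OF True]]
          colon_neq_zero[OF True] one_in_star_colon_iff[OF S True])
    then have "x \<in> star_of (ideals_of star) E \<longleftrightarrow> x \<in> star E" for x
      by (simp add: mem_star_of_iff[OF ideals_of_in_LS[OF S'] True])
    then show ?thesis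
      by blast
  next
    case False
    then show ?thesis
      using S' by (auto simp: star_of_def SStar_def PiE_def extensional_def)
  qed
qed


section \<open>The Zariski topologies\<close>

lemma continuous_map_star_of: "continuous_map LS_zariski stable_SStar_zariski star_of"
  unfolding stable_SStar_zariski_def
proof (rule continuous_map_into_subtopology)
  show "star_of \<in> topspace (LS_zariski :: 'a set set topology) \<rightarrow> stable_SStar"
    using star_of_stable_SStar by (auto simp: topspace_LS_zariski)
  show "continuous_map (LS_zariski :: 'a set set topology) SStar_zariski star_of"
    unfolding SStar_zariski_def
  proof (rule continuous_on_generated_topo)
    fix U :: "('a fract set \<Rightarrow> 'a fract set) set"
    assume "U \<in> (\<lambda>E. {star \<in> SStar. 1 \<in> star E}) ` Fbar"
    then obtain E where E: "E \<in> Fbar" and U: "U = {star \<in> SStar. 1 \<in> star E}"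
      by blast
    have "star_of -` U \<inter> topspace LS_zariski = {\<F> \<in> LS. colon E 1 \<in> \<F>}"
      using star_of_stable_SStar
      by (auto simp: U topspace_LS_zariski mem_star_of_iff[OF _ E] stable_SStar_def)
    then show "openin LS_zariski (star_of -` U \<inter> topspace LS_zariski)"
      using D_ideal_colon[OF Fbar_submodule[OF E]]
      by (auto simp: LS_zariski_def intro!: topology_generated_by_Basis)
  next
    have "\<Union> ((\<lambda>E. {star \<in> SStar. 1 \<in> star E}) ` Fbar)
        = (SStar :: ('a fract set \<Rightarrow> 'a fract set) set)"
      using topspace_SStar_zariski
      unfolding SStar_zariski_def topology_generated_by_topspace .
    moreover have "star_of \<F> \<in> SStar" if "\<F> \<in> LS" for \<F> :: "'a set set"
      using star_of_stable_SStar[OF that] by (simp add: stable_SStar_def)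
    ultimately show "star_of ` topspace (LS_zariski :: 'a set set topology)
        \<subseteq> \<Union> ((\<lambda>E. {star \<in> SStar. 1 \<in> star E}) ` Fbar)"
      unfolding topspace_LS_zariski by blast
  qed
qed

lemma continuous_map_ideals_of: "continuous_map stable_SStar_zariski LS_zariski ideals_of"
  unfolding LS_zariski_def
proof (rule continuous_on_generated_topo)
  fix U :: "'a set set set"
  assume "U \<in> (\<lambda>I. {\<F> \<in> LS. I \<in> \<F>}) ` {I. D_ideal I}"
  then obtain I where I: "D_ideal I" and U: "U = {\<F> \<in> LS. I \<in> \<F>}"
    by blast
  show "openin stable_SStar_zariski (ideals_of -` U \<inter> topspace stable_SStar_zariski)"
  proof (cases "I = {0}")
    case True
    then have "ideals_of -` U = {}"
      by (auto simp: U ideals_of_def)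
    then show ?thesis
      by simp
  next
    case False
    let ?V = "{star \<in> SStar. 1 \<in> star (to_fract ` I)}"
    have "openin SStar_zariski ?V"
      unfolding SStar_zariski_def
      by (rule topology_generated_by_Basis) (use ideal_in_Fbar[OF I False] in blast)
    moreover have "ideals_of -` U \<inter> topspace stable_SStar_zariski = ?V \<inter> stable_SStar"
      using I False ideals_of_in_LS
      by (auto simp: U topspace_stable_SStar_zariski ideals_of_def stable_SStar_def)
    ultimately show ?thesis
      unfolding stable_SStar_zariski_def openin_subtopology by blast
  qed
next
  show "ideals_of ` topspace (stable_SStar_zariski :: ('a fract set \<Rightarrow> 'a fract set) topology)
      \<subseteq> \<Union> ((\<lambda>I. {\<F> \<in> LS. I \<in> \<F>}) ` {I. D_ideal I})"
    using ideals_of_in_LS topspace_LS_zariski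
    unfolding topspace_stable_SStar_zariski LS_zariski_def topology_generated_by_topspace
    by (auto simp: stable_SStar_def)
qed

theorem proposition3p5:
  shows "homeomorphic_map (LS_zariski :: 'a::idom set set topology)
           (stable_SStar_zariski :: ('a fract set \<Rightarrow> 'a fract set) topology)
           star_of"
proof (rule homeomorphic_maps_imp_map)
  show "homeomorphic_maps LS_zariski stable_SStar_zariski star_of ideals_of"
    by (simp add: homeomorphic_maps_def continuous_map_star_of continuous_map_ideals_of
        topspace_LS_zariski topspace_stable_SStar_zariski ideals_of_star_of star_of_ideals_of)
qed

end
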